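(* Let $V$ be a finite set with $|V|\ge2$, let $m\ge 1$ be an integer, let $\mathbf r=(r(x,k)\colon x\in V,\ k\in\mathbb N)$ be a collection of positive numbers, and let $P$ be an irreducible stochastic matrix on $V$ with invariant law $\pi$. Let $\Pi$ be the matrix on $V$ given by $\Pi(x,y)=\pi(y)$. Then for all $f\colon\Omega\to\mathbb R$, $$\mathcal E_{\mathrm{zrp}(P,\mathbf r,m)}(f,f)\ \ge\ \lambda(P)\,\mathcal E_{\mathrm{zrp}(\Pi,\mathbf r,m)}(f,f).$$ Moreover, the constant $\lambda(P)$ is optimal, i.e. there exists a non-constant $f\colon\Omega\to\mathbb R$ for which equality holds.
   Context: $\mathbb N=\{1,2,\dots\}$, $\mathbb Z_+=\{0,1,2,\dots\}$. The state space is $\Omega=\{\eta\in\mathbb Z_+^V\colon \sum_{x\in V}\eta(x)=m\}$; $(\delta_x)_{x\in V}$ is the canonical basis of $\mathbb R^V$; by convention $r(x,0)=0$ for all $x\in V$. For a stochastic matrix $R$ on $V$ with stationary law $\pi$ (here $R=P$ or $R=\Pi$), the zero-range process $\mathrm{zrp}(R,\mathbf r,m)$ is the continuous-time Markov chain on $\Omega$ with generator $$(\mathcal L_R f)(\eta)=\sum_{(x,y)\in V^2} r(x,\eta(x))\,R(x,y)\,\bigl(f(\eta+\delta_y-\delta_x)-f(\eta)\bigr)$$ (terms with $\eta(x)=0$ being zero). Its stationary law is $$\mu(\eta)=\frac1Z\prod_{x\in V}\prod_{k=1}^{\eta(x)}\frac{\pi(x)}{r(x,k)},$$ with $Z$ the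 normalization constant making $\mu$ a probability on $\Omega$. Its Dirichlet form is $\mathcal E_{\mathrm{zrp}(R,\mathbf r,m)}(f,g)=-\langle f,\mathcal L_R g\rangle_\mu$, where $\langle f,g\rangle_\mu=\sum_{\eta\in\Omega}\mu(\eta)f(\eta)g(\eta)$. The Dirichlet form of $P$ is $\mathcal E_P(\phi,\psi)=\langle\phi,(I-P)\psi\rangle_\pi$, where $\langle\phi,\psi\rangle_\pi=\sum_{x\in V}\pi(x)\phi(x)\psi(x)$, and the Poincaré constant of $P$ is $\lambda(P)=\min_\phi \mathcal E_P(\phi,\phi)/\mathrm{Var}_\pi(\phi)$, the minimum being over non-constant $\phi\colon V\to\mathbb R$. No reversibility is assumed. *)

theory Defs
  imports "HOL-Analysis.Analysis"
begin

definition stochastic_matrix :: "real ^ 'v ^ 'v \<Rightarrow> bool" where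
  "stochastic_matrix P \<longleftrightarrow> (\<forall>x y. 0 \<le> P $ x $ y) \<and> (\<forall>x. (\<Sum>y\<in>UNIV. P $ x $ y) = 1)"

definition matrix_power :: "real ^ 'v ^ 'v \<Rightarrow> nat \<Rightarrow> real ^ 'v ^ 'v" where
  "matrix_power P n = ((\<lambda>Q. P ** Q) ^^ n) (mat 1)"

definition irreducible_matrix :: "real ^ 'v ^ 'v \<Rightarrow> bool" where
  "irreducible_matrix P \<longleftrightarrow> (\<forall>x y. \<exists>n. 0 < matrix_power P n $ x $ y)"

definition invariant_law :: "real ^ 'v ^ 'v \<Rightarrow> real ^ 'v \<Rightarrow> bool" where
  "invariant_law P \<pi> \<longleftrightarrow>
     (\<forall>x. 0 \<le> \<pi> $ x) \<and> (\<Sum>x\<in>UNIV. \<pi> $ x) = 1 \<and> \<pi> v* P = \<pi>"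

definition weighted_inner :: "'s set \<Rightarrow> ('s \<Rightarrow> real) \<Rightarrow> ('s \<Rightarrow> real) \<Rightarrow> ('s \<Rightarrow> real) \<Rightarrow> real" where
  "weighted_inner S \<mu> f g = (\<Sum>s\<in>S. \<mu> s * f s * g s)"

definition dirichlet_form ::
    "real ^ 'v ^ 'v \<Rightarrow> real ^ 'v \<Rightarrow> real ^ 'v \<Rightarrow> real ^ 'v \<Rightarrow> real" where
  "dirichlet_form P \<pi> \<phi> \<psi> =
     weighted_inner UNIV (($) \<pi>) (($) \<phi>) (($) ((mat 1 - P) *v \<psi>))"

definition mean :: "real ^ 'v \<Rightarrow> real ^ 'v \<Rightarrow> real" where
  "mean \<pi> \<phi> = (\<Sum>x\<in>UNIV. \<pi> $ x * \<phi> $ x)"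

definition variance :: "real ^ 'v \<Rightarrow> real ^ 'v \<Rightarrow> real" where
  "variance \<pi> \<phi> = (\<Sum>x\<in>UNIV. \<pi> $ x * (\<phi> $ x - mean \<pi> \<phi>)\<^sup>2)"

(* The least element of an infinite set of reals, i.e. a minimum that is attained. It says nothing
   unless the minimum exists, so any use has to establish attainment. *)
definition poincare_constant :: "real ^ 'v ^ 'v \<Rightarrow> real ^ 'v \<Rightarrow> real" where
  "poincare_constant P \<pi> =
     (LEAST l. \<exists>\<phi> :: real ^ 'v. \<not> ($) \<phi> constant_on UNIV \<and>
                  l = dirichlet_form P \<pi> \<phi> \<phi> / variance \<pi> \<phi>)"

definition configurations :: "nat \<Rightarrow> ('v::finite \<Rightarrow> nat) set" where
  "configurations m = {\<eta>. (\<Sum>x\<in>UNIV. \<eta> x) = m}"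

(* \<eta> + \<delta>_y - \<delta>_x. The addition comes first, so the subtraction does not truncate when \<eta> x > 0;
   in the generator the remaining case is multiplied by r x 0 = 0. *)
definition move :: "'v \<Rightarrow> 'v \<Rightarrow> ('v \<Rightarrow> nat) \<Rightarrow> ('v \<Rightarrow> nat)" where
  "move x y \<eta> = (\<lambda>z. \<eta> z + of_bool (z = y) - of_bool (z = x))"

definition zrp_generator ::
    "real ^ 'v ^ 'v \<Rightarrow> ('v \<Rightarrow> nat \<Rightarrow> real) \<Rightarrow> (('v \<Rightarrow> nat) \<Rightarrow> real) \<Rightarrow> ('v::finite \<Rightarrow> nat) \<Rightarrow> real" where
  "zrp_generator R r f \<eta> =
     (\<Sum>(x, y)\<in>UNIV. r x (\<eta> x) * R $ x $ y * (f (move x y \<eta>) - f \<eta>))"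

definition zrp_weight :: "real ^ 'v \<Rightarrow> ('v \<Rightarrow> nat \<Rightarrow> real) \<Rightarrow> ('v::finite \<Rightarrow> nat) \<Rightarrow> real" where
  "zrp_weight \<pi> r \<eta> = (\<Prod>x\<in>UNIV. \<Prod>k=1..\<eta> x. \<pi> $ x / r x k)"

definition zrp_law ::
    "real ^ 'v \<Rightarrow> ('v \<Rightarrow> nat \<Rightarrow> real) \<Rightarrow> nat \<Rightarrow> ('v::finite \<Rightarrow> nat) \<Rightarrow> real" where
  "zrp_law \<pi> r m \<eta> = zrp_weight \<pi> r \<eta> / (\<Sum>\<xi>\<in>configurations m. zrp_weight \<pi> r \<xi>)"

(* The argument \<pi> is the stationary law of R; it enters through the weights of the inner product. *)
definition zrp_dirichlet_form ::
    "real ^ 'v ^ 'v \<Rightarrow> real ^ 'v \<Rightarrow> ('v \<Rightarrow> nat \<Rightarrow> real) \<Rightarrow> nat \<Rightarrow>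
     (('v::finite \<Rightarrow> nat) \<Rightarrow> real) \<Rightarrow> (('v \<Rightarrow> nat) \<Rightarrow> real) \<Rightarrow> real" where
  "zrp_dirichlet_form R \<pi> r m f g =
     - weighted_inner (configurations m) (zrp_law \<pi> r m) f (zrp_generator R r g)"

definition constant_rows :: "real ^ 'v \<Rightarrow> real ^ 'v ^ 'v" where
  "constant_rows \<pi> = (\<chi> x y. \<pi> $ y)"

end

theory Submission
  imports Defs
begin

text \<open>
  Since \<open>\<mu>(\<eta>) r(x, \<eta>(x))\<close> is proportional to \<open>\<pi>(x)\<close> times the weight of \<open>\<eta> - \<delta>\<^sub>x\<close>, the Dirichlet form of
  the zero-range process driven by \<open>R\<close> is a weighted sum, over configurations \<open>\<xi>\<close> of \<open>m - 1\<close>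
  particles, of the forms \<open>\<E>\<^sub>R(\<phi>\<^sub>\<xi>, \<phi>\<^sub>\<xi>)\<close> with \<open>\<phi>\<^sub>\<xi>(x) = f(\<xi> + \<delta>\<^sub>x)\<close>, and the weights do not depend on \<open>R\<close>.
  For \<open>R = \<Pi>\<close> these forms are variances, so the Poincare inequality of \<open>P\<close> applies term by term.
  If \<open>\<phi>\<close> attains \<open>\<lambda>(P)\<close> and \<open>f(\<eta>) = \<Sum>\<^sub>x \<phi>(x) \<eta>(x)\<close>, every \<open>\<phi>\<^sub>\<xi>\<close> is \<open>\<phi>\<close> plus a constant, which
  gives equality.
\<close>

subsection \<open>The Poincare constant of a finite chain\<close>

lemma matrix_power_nonneg:
  assumes "stochastic_matrix P"
  shows "0 \<le> matrix_power P n $ x $ y"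
proof (induction n arbitrary: x y)
  case 0
  then show ?case
    by (simp add: matrix_power_def mat_def)
next
  case (Suc n)
  then show ?case
    using assms
    by (auto simp: matrix_power_def matrix_matrix_mult_def stochastic_matrix_def intro!: sum_nonneg)
qed

lemma invariant_law_matrix_power:
  assumes "invariant_law P \<pi>"
  shows "\<pi> v* matrix_power P n = \<pi>"
proof (induction n)
  case 0
  then show ?case
    by (simp add: matrix_power_def)
next
  case (Suc n)
  then show ?case
    using assms
    by (simp add: matrix_power_def invariant_law_def flip: vector_matrix_mul_assoc)
qed

text \<open>Some state x carries mass, and irreducibility gives an n for which the n-step transition
  from x to y has positive probability. Since the law is also invariant under the n-th power, this
  transports mass to y. Full support is what makes the variance of every non-constant function
  positive.\<close>

lemma invariant_law_pos:
  fixes \<pi> :: "real ^ 'v"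
  assumes "stochastic_matrix P" "irreducible_matrix P" "invariant_law P \<pi>"
  shows "0 < \<pi> $ y"
proof -
  have nn: "\<And>x. 0 \<le> \<pi> $ x" and "(\<Sum>x\<in>UNIV. \<pi> $ x) = 1"
    using assms(3) by (auto simp: invariant_law_def)
  then obtain x where x: "0 < \<pi> $ x"
    by (metis less_eq_real_def sum.neutral zero_neq_one)
  obtain n where n: "0 < matrix_power P n $ x $ y"
    using assms(2) by (auto simp: irreducible_matrix_def)
  have "0 < \<pi> $ x * matrix_power P n $ x $ y"
    using x n by simp
  also have "\<dots> \<le> (\<Sum>z\<in>UNIV. \<pi> $ z * matrix_power P n $ z $ y)"
    by (rule member_le_sum) (auto simp: nn matrix_power_nonneg[OF assms(1)])
  also have "\<dots> = (\<pi> v* matrix_power P n) $ y"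
    by (simp add: vector_matrix_mult_def mult.commute)
  also have "\<dots> = \<pi> $ y"
    by (simp add: invariant_law_matrix_power[OF assms(3)])
  finally show ?thesis .
qed

section \<open>Dirichlet form, mean and variance: shifts, scaling and continuity\<close>

lemma dirichlet_form_eq_sum:
  assumes "stochastic_matrix P"
  shows "dirichlet_form P \<pi> \<phi> \<psi> =
    (\<Sum>x\<in>UNIV. \<Sum>y\<in>UNIV. \<pi> $ x * P $ x $ y * \<phi> $ x * (\<psi> $ x - \<psi> $ y))"
proof -
  have "((mat 1 - P) *v \<psi>) $ x = (\<Sum>y\<in>UNIV. P $ x $ y * (\<psi> $ x - \<psi> $ y))" for x
  proof -
    have "((mat 1 - P) *v \<psi>) $ x = \<psi> $ x - (\<Sum>y\<in>UNIV. P $ x $ y * \<psi> $ y)"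
      by (simp add: matrix_vector_mult_diff_rdistrib) (simp add: matrix_vector_mult_def)
    \<comment> \<open>Row sums equal to 1 allow \<open>\<psi> $ x\<close> to be averaged over y, so
      that only differences of \<open>\<psi>\<close> remain.\<close>
    also have "\<psi> $ x = (\<Sum>y\<in>UNIV. P $ x $ y) * \<psi> $ x"
      using assms by (simp add: stochastic_matrix_def)
    finally show ?thesis
      by (simp add: sum_distrib_right right_diff_distrib sum_subtractf)
  qed
  then show ?thesis
    by (simp add: dirichlet_form_def weighted_inner_def sum_distrib_left mult_ac)
qed

text \<open>In the second argument the shift cancels in the differences. In the first it contributes
  c times the expected decrement of \<open>\<phi>\<close> in one stationary step, which vanishes
  because both endpoints of the step have law \<open>\<pi>\<close>. Invariance replaces
  reversibility here.\<close>

lemma dirichlet_form_add_const: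
  assumes "stochastic_matrix P" "invariant_law P \<pi>"
  shows "dirichlet_form P \<pi> (\<phi> + vec c) (\<phi> + vec c) = dirichlet_form P \<pi> \<phi> \<phi>"
proof -
  have col: "(\<Sum>x\<in>UNIV. \<pi> $ x * P $ x $ y) = \<pi> $ y" for y
  proof -
    have "(\<pi> v* P) $ y = \<pi> $ y"
      using assms(2) by (simp add: invariant_law_def)
    then show ?thesis
      by (simp add: vector_matrix_mult_def mult.commute)
  qed
  have row: "(\<Sum>y\<in>UNIV. P $ x $ y) = 1" for x
    using assms(1) by (simp add: stochastic_matrix_def)
  have "(\<Sum>x\<in>UNIV. \<Sum>y\<in>UNIV. \<pi> $ x * P $ x $ y * \<phi> $ x) = (\<Sum>x\<in>UNIV. \<pi> $ x * \<phi> $ x)"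
    by (simp add: row mult_ac flip: sum_distrib_left)
  moreover have "(\<Sum>x\<in>UNIV. \<Sum>y\<in>UNIV. \<pi> $ x * P $ x $ y * \<phi> $ y) = (\<Sum>x\<in>UNIV. \<pi> $ x * \<phi> $ x)"
    by (subst sum.swap) (simp add: col flip: sum_distrib_right)
  ultimately have "(\<Sum>x\<in>UNIV. \<Sum>y\<in>UNIV. \<pi> $ x * P $ x $ y * (\<phi> $ x - \<phi> $ y)) = 0"
    by (simp add: right_diff_distrib sum_subtractf)
  moreover have "dirichlet_form P \<pi> (\<phi> + vec c) (\<phi> + vec c) = dirichlet_form P \<pi> \<phi> \<phi> +
      c * (\<Sum>x\<in>UNIV. \<Sum>y\<in>UNIV. \<pi> $ x * P $ x $ y * (\<phi> $ x - \<phi> $ y))"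
  proof -
    have "\<pi> $ x * P $ x $ y * (\<phi> $ x + c) * (\<phi> $ x - \<phi> $ y) =
        \<pi> $ x * P $ x $ y * \<phi> $ x * (\<phi> $ x - \<phi> $ y) +
        c * (\<pi> $ x * P $ x $ y * (\<phi> $ x - \<phi> $ y))" for x y
      by (simp add: algebra_simps)
    then show ?thesis
      by (simp add: dirichlet_form_eq_sum[OF assms(1)] sum.distrib sum_distrib_left)
  qed
  ultimately show ?thesis
    by simp
qed

lemma dirichlet_form_scaleR:
  "dirichlet_form P \<pi> (a *\<^sub>R \<phi>) (a *\<^sub>R \<phi>) = a\<^sup>2 * dirichlet_form P \<pi> \<phi> \<phi>"
  by (simp add: dirichlet_form_def weighted_inner_def matrix_vector_mult_scaleR sum_distrib_left
      power2_eq_square mult_ac)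

lemma continuous_on_dirichlet_form:
  "continuous_on A (\<lambda>\<phi>. dirichlet_form P \<pi> \<phi> \<phi>)"
  unfolding dirichlet_form_def weighted_inner_def matrix_vector_mult_def
  by (auto intro!: continuous_intros)

lemma mean_add_const:
  assumes "(\<Sum>x\<in>UNIV. \<pi> $ x) = 1"
  shows "mean \<pi> (\<phi> + vec c) = mean \<pi> \<phi> + c"
  using assms by (simp add: mean_def distrib_left sum.distrib flip: sum_distrib_right)

lemma mean_scaleR: "mean \<pi> (a *\<^sub>R \<phi>) = a * mean \<pi> \<phi>"
  by (simp add: mean_def sum_distrib_left mult_ac)

lemma continuous_on_mean: "continuous_on A (mean \<pi>)"
  unfolding mean_def by (auto intro!: continuous_intros)

lemma variance_add_const:
  assumes "(\<Sum>x\<in>UNIV. \<pi> $ x) = 1"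
  shows "variance \<pi> (\<phi> + vec c) = variance \<pi> \<phi>"
  by (simp add: variance_def mean_add_const[OF assms])

lemma variance_scaleR: "variance \<pi> (a *\<^sub>R \<phi>) = a\<^sup>2 * variance \<pi> \<phi>"
  by (simp add: variance_def mean_scaleR sum_distrib_left mult_ac power_mult_distrib
      flip: right_diff_distrib)

lemma continuous_on_variance: "continuous_on A (variance \<pi>)"
  unfolding variance_def by (auto intro!: continuous_intros continuous_on_mean)

lemma variance_pos:
  assumes pos: "\<And>x. 0 < \<pi> $ x" and "\<not> ($) \<phi> constant_on UNIV"
  shows "0 < variance \<pi> \<phi>"
proof -
  obtain x where "\<phi> $ x \<noteq> mean \<pi> \<phi>"
    using assms(2) by (auto simp: constant_on_def)
  then have "0 < \<pi> $ x * (\<phi> $ x - mean \<pi> \<phi>)\<^sup>2"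
    using pos by simp
  also have "\<dots> \<le> variance \<pi> \<phi>"
    unfolding variance_def by (rule member_le_sum) (auto simp: pos less_imp_le)
  finally show ?thesis .
qed

lemma variance_constant:
  assumes "(\<Sum>x\<in>UNIV. \<pi> $ x) = 1" "($) \<phi> constant_on UNIV"
  shows "variance \<pi> \<phi> = 0"
proof -
  obtain c where "\<And>x. \<phi> $ x = c"
    using assms(2) by (auto simp: constant_on_def)
  then show ?thesis
    using assms(1) by (simp add: variance_def mean_def flip: sum_distrib_right)
qed

lemma dirichlet_form_constant:
  assumes "stochastic_matrix P" "($) \<phi> constant_on UNIV"
  shows "dirichlet_form P \<pi> \<phi> \<phi> = 0"
  using assms(2) by (auto simp: dirichlet_form_eq_sum[OF assms(1)] constant_on_def)

text \<open>The Rayleigh quotient is invariant under shifts and scaling, so it suffices to minimise it over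
  the compact set of centred unit vectors.\<close>

lemma poincare_minimizer_exists:
  fixes P :: "real ^ 'v ^ 'v"
  assumes card: "CARD('v) \<ge> 2"
    and P: "stochastic_matrix P" "irreducible_matrix P" "invariant_law P \<pi>"
  obtains \<phi> where "\<not> ($) \<phi> constant_on UNIV"
    and "\<And>\<psi>. \<not> ($) \<psi> constant_on UNIV \<Longrightarrow>
      dirichlet_form P \<pi> \<phi> \<phi> / variance \<pi> \<phi> \<le> dirichlet_form P \<pi> \<psi> \<psi> / variance \<pi> \<psi>"
proof -
  define q where "q = (\<lambda>\<phi>. dirichlet_form P \<pi> \<phi> \<phi> / variance \<pi> \<phi>)"
  define K where "K = sphere 0 1 \<inter> {\<phi> :: real ^ 'v. mean \<pi> \<phi> = 0}"
  have pos: "\<And>x. 0 < \<pi> $ x"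
    using invariant_law_pos[OF P] .
  have sum1: "(\<Sum>x\<in>UNIV. \<pi> $ x) = 1"
    using P(3) by (simp add: invariant_law_def)
  \<comment> \<open>A constant with mean 0 is the zero vector, which is not on the unit sphere.
    Hence the variance does not vanish on \<open>K\<close>, and \<open>q\<close> is continuous
    there.\<close>
  have nonconst: "\<not> ($) \<phi> constant_on UNIV" if "\<phi> \<in> K" for \<phi>
  proof
    assume "($) \<phi> constant_on UNIV"
    then obtain c where c: "\<And>x. \<phi> $ x = c"
      by (auto simp: constant_on_def)
    have "mean \<pi> \<phi> = c"
      using sum1 by (simp add: mean_def c flip: sum_distrib_right)
    then have "\<phi> = 0"
      using that c by (simp add: K_def vec_eq_iff)
    then show False
      using that by (simp add: K_def)
  qed
  have reduce: "\<exists>\<theta>\<in>K. q \<theta> = q \<psi>" if "\<not> ($) \<psi> constant_on UNIV" for \<psi>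
  proof -
    \<comment> \<open>First centre, then normalise in the Euclidean norm; the factor from scaling is
      squared in both numerator and denominator of \<open>q\<close> and cancels.\<close>
    define \<psi>' where "\<psi>' = \<psi> + vec (- mean \<pi> \<psi>)"
    define \<theta> where "\<theta> = (1 / norm \<psi>') *\<^sub>R \<psi>'"
    have "\<psi>' \<noteq> 0"
      using that by (auto simp: \<psi>'_def vec_eq_iff constant_on_def)
    moreover have "mean \<pi> \<psi>' = 0"
      by (simp add: \<psi>'_def mean_add_const[OF sum1] del: vec_neg)
    ultimately have "\<theta> \<in> K"
      by (simp add: \<theta>_def K_def mean_scaleR)
    moreover have "q \<theta> = q \<psi>'"
      using \<open>\<psi>' \<noteq> 0\<close> by (simp add: q_def \<theta>_def dirichlet_form_scaleR variance_scaleR)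
    moreover have "q \<psi>' = q \<psi>"
      unfolding q_def \<psi>'_def dirichlet_form_add_const[OF P(1,3)] variance_add_const[OF sum1] ..
    ultimately show ?thesis
      by auto
  qed
  \<comment> \<open>With two distinct states an indicator vector is non-constant, and its reduction
    shows that \<open>K\<close> is nonempty.\<close>
  obtain a b :: 'v where "a \<noteq> b"
    using card by (metis One_nat_def card_1_singleton_iff card_2_iff' ex_card UNIV_I)
  then have "\<not> ($) (axis a 1 :: real ^ 'v) constant_on UNIV"
    by (auto simp: constant_on_def axis_def) (metis zero_neq_one)
  then have "K \<noteq> {}"
    using reduce by blast
  moreover have "compact K"
    unfolding K_def
    by (intro compact_Int_closed compact_sphere closed_Collect_eq continuous_on_mean continuous_on_const)
  moreover have "continuous_on K q"
    unfolding q_def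
    using variance_pos[OF pos nonconst]
    by (intro continuous_on_divide continuous_on_dirichlet_form continuous_on_variance) force
  ultimately obtain \<phi> where "\<phi> \<in> K" "\<And>\<psi>. \<psi> \<in> K \<Longrightarrow> q \<phi> \<le> q \<psi>"
    using continuous_attains_inf by metis
  then have "\<And>\<psi>. \<not> ($) \<psi> constant_on UNIV \<Longrightarrow> q \<phi> \<le> q \<psi>"
    using reduce by metis
  with nonconst[OF \<open>\<phi> \<in> K\<close>] show ?thesis
    using that unfolding q_def by blast
qed

text \<open>The minimizer supplies the attainment that the \<open>LEAST\<close> in the definition of
  the constant requires. Multiplying by the positive variance turns the bound on quotients into the
  inequality; for constant functions both sides are 0.\<close>

lemma
  fixes P :: "real ^ 'v ^ 'v"
  assumes card: "CARD('v) \<ge> 2"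
    and P: "stochastic_matrix P" "irreducible_matrix P" "invariant_law P \<pi>"
  shows poincare_constant_attained:
      "\<exists>\<phi>. \<not> ($) \<phi> constant_on UNIV \<and>
        dirichlet_form P \<pi> \<phi> \<phi> = poincare_constant P \<pi> * variance \<pi> \<phi>" (is ?attained)
    and poincare_inequality:
      "\<And>\<psi>. poincare_constant P \<pi> * variance \<pi> \<psi> \<le> dirichlet_form P \<pi> \<psi> \<psi>" (is "\<And>\<psi>. ?ineq \<psi>")
proof -
  obtain \<phi> where \<phi>: "\<not> ($) \<phi> constant_on UNIV"
    and min: "\<And>\<psi>. \<not> ($) \<psi> constant_on UNIV \<Longrightarrow>
      dirichlet_form P \<pi> \<phi> \<phi> / variance \<pi> \<phi> \<le> dirichlet_form P \<pi> \<psi> \<psi> / variance \<pi> \<psi>"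
    using poincare_minimizer_exists[OF assms] by metis
  have eq: "poincare_constant P \<pi> = dirichlet_form P \<pi> \<phi> \<phi> / variance \<pi> \<phi>"
    unfolding poincare_constant_def by (rule Least_equality) (use \<phi> min in auto)
  have var: "0 < variance \<pi> \<psi>" if "\<not> ($) \<psi> constant_on UNIV" for \<psi>
    using variance_pos[OF invariant_law_pos[OF P] that] .
  show ?attained
    using \<phi> var[OF \<phi>] by (intro exI[of _ \<phi>]) (simp add: eq)
  have sum1: "(\<Sum>x\<in>UNIV. \<pi> $ x) = 1"
    using P(3) by (simp add: invariant_law_def)
  show "?ineq \<psi>" for \<psi>
  proof (cases "($) \<psi> constant_on UNIV")
    case True
    then show ?thesis
      by (simp add: variance_constant[OF sum1] dirichlet_form_constant[OF P(1)])
  next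
    case False
    then show ?thesis
      using min[OF False] var[OF False] by (simp add: eq field_simps)
  qed
qed

section \<open>The chain with constant rows\<close>

lemma stochastic_constant_rows:
  assumes "invariant_law P \<pi>"
  shows "stochastic_matrix (constant_rows \<pi>)"
  using assms by (simp add: stochastic_matrix_def invariant_law_def constant_rows_def)

text \<open>Applying I minus this matrix subtracts the mean, and the centred function is orthogonal
  to constants in the \<open>\<pi>\<close>-weighted inner product.\<close>

lemma dirichlet_form_constant_rows:
  assumes "(\<Sum>x\<in>UNIV. \<pi> $ x) = 1"
  shows "dirichlet_form (constant_rows \<pi>) \<pi> \<phi> \<phi> = variance \<pi> \<phi>"
proof -
  define M where "M = mean \<pi> \<phi>"
  have sum: "(\<Sum>x\<in>UNIV. \<pi> $ x * \<phi> $ x) = M"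
    by (simp add: M_def mean_def)
  have "((mat 1 - constant_rows \<pi>) *v \<phi>) $ x = \<phi> $ x - M" for x
    by (simp add: matrix_vector_mult_diff_rdistrib)
      (simp add: matrix_vector_mult_def constant_rows_def sum)
  then have "dirichlet_form (constant_rows \<pi>) \<pi> \<phi> \<phi> = (\<Sum>x\<in>UNIV. \<pi> $ x * \<phi> $ x * (\<phi> $ x - M))"
    by (simp add: dirichlet_form_def weighted_inner_def)
  \<comment> \<open>The bracketed correction sums to M times M minus \<open>M\<^sup>2\<close>, that
    is, to 0.\<close>
  also have "\<dots> = (\<Sum>x\<in>UNIV. \<pi> $ x * (\<phi> $ x - M)\<^sup>2 + (M * (\<pi> $ x * \<phi> $ x) - M\<^sup>2 * \<pi> $ x))"
    by (intro sum.cong refl) (simp add: algebra_simps power2_eq_square)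
  also have "\<dots> = variance \<pi> \<phi>"
    by (simp add: variance_def sum.distrib sum_subtractf sum assms power2_eq_square
        flip: sum_distrib_left M_def)
  finally show ?thesis .
qed

subsection \<open>Decomposition of the zero-range Dirichlet form\<close>

definition add_particle :: "'v \<Rightarrow> ('v \<Rightarrow> nat) \<Rightarrow> 'v \<Rightarrow> nat" where
  "add_particle x \<xi> = \<xi>(x := Suc (\<xi> x))"

lemma add_particle_apply: "add_particle x \<xi> x = Suc (\<xi> x)"
  by (simp add: add_particle_def)

text \<open>Freezing the other particles as a background \<open>\<xi>\<close>, a jump only relocates
  the added one. Zero-range increments thereby become differences of a function on the sites. The
  case x = y is included because \<open>move\<close> adds before it subtracts.\<close>

lemma move_add_particle: "move x y (add_particle x \<xi>) = add_particle y \<xi>"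
  by (auto simp: move_def add_particle_def fun_eq_iff)

text \<open>The general semiring serves two uses: weight 1 over the naturals counts particles, and a
  real weight evaluates the linear function that gives equality in the main result.\<close>

lemma sum_add_particle:
  fixes \<xi> :: "'v::finite \<Rightarrow> nat" and g :: "'v \<Rightarrow> 'a::comm_semiring_1"
  shows "(\<Sum>z\<in>UNIV. g z * of_nat (add_particle x \<xi> z)) = (\<Sum>z\<in>UNIV. g z * of_nat (\<xi> z)) + g x"
proof -
  have "g z * of_nat (add_particle x \<xi> z) = g z * of_nat (\<xi> z) + (if z = x then g z else 0)" for z
    by (simp add: add_particle_def distrib_left add.commute)
  then show ?thesis
    by (simp add: sum.distrib)
qed

lemma add_particle_in_configurations:
  "add_particle x \<xi> \<in> configurations (Suc n) \<longleftrightarrow> \<xi> \<in> configurations n"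
  using sum_add_particle[of "\<lambda>_. 1 :: nat" x \<xi>] by (simp add: configurations_def)

lemma finite_configurations: "finite (configurations m :: ('v::finite \<Rightarrow> nat) set)"
proof (rule finite_subset)
  show "configurations m \<subseteq> (UNIV :: 'v set) \<rightarrow>\<^sub>E {..m}"
    by (auto simp: configurations_def intro: member_le_sum)
qed (simp add: finite_PiE)

text \<open>The inverse removes a particle from x; on configurations occupied at x the natural
  subtraction does not truncate.\<close>

lemma bij_betw_add_particle:
  "bij_betw (add_particle x) (configurations n) {\<eta> \<in> configurations (Suc n). \<eta> x \<noteq> 0}"
proof (rule bij_betw_byWitness[where f' = "\<lambda>\<eta>. \<eta>(x := \<eta> x - 1)"])
  have inv: "add_particle x (\<eta>(x := \<eta> x - 1)) = \<eta>" if "\<eta> x \<noteq> 0" for \<eta>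
    using that by (auto simp: add_particle_def)
  then show "\<forall>\<eta>\<in>{\<eta> \<in> configurations (Suc n). \<eta> x \<noteq> 0}. add_particle x (\<eta>(x := \<eta> x - 1)) = \<eta>"
    by simp
  show "(\<lambda>\<eta>. \<eta>(x := \<eta> x - 1)) ` {\<eta> \<in> configurations (Suc n). \<eta> x \<noteq> 0} \<subseteq> configurations n"
  proof (rule image_subsetI)
    fix \<eta> assume "\<eta> \<in> {\<eta> \<in> configurations (Suc n). \<eta> x \<noteq> 0}"
    then have "add_particle x (\<eta>(x := \<eta> x - 1)) \<in> configurations (Suc n)"
      using inv by simp
    then show "\<eta>(x := \<eta> x - 1) \<in> configurations n"
      by (simp only: add_particle_in_configurations)
  qed
  show "add_particle x ` configurations n \<subseteq> {\<eta> \<in> configurations (Suc n). \<eta> x \<noteq> 0}"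
    by (auto simp: add_particle_in_configurations) (simp add: add_particle_def)
qed (simp add: add_particle_def)

section \<open>Stationary weights and the change of variables to one particle fewer\<close>

lemma zrp_weight_nonneg:
  assumes "\<forall>x. \<forall>k\<ge>1. 0 < r x k" "\<And>x. 0 \<le> \<pi> $ x"
  shows "0 \<le> zrp_weight \<pi> r \<eta>"
  unfolding zrp_weight_def using assms by (intro prod_nonneg) (auto intro!: divide_nonneg_pos)

text \<open>The new particle contributes exactly one factor, whose denominator is the rate at which
  site x then releases a particle. Multiplying by that rate cancels it.\<close>

lemma zrp_weight_add_particle:
  assumes "\<forall>x. \<forall>k\<ge>1. 0 < r x k"
  shows "zrp_weight \<pi> r (add_particle x \<xi>) * r x (Suc (\<xi> x)) = zrp_weight \<pi> r \<xi> * \<pi> $ x"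
proof -
  have eq: "(\<Prod>k=1..add_particle x \<xi> z. \<pi> $ z / r z k) =
      (\<Prod>k=1..\<xi> z. \<pi> $ z / r z k) * (if z = x then \<pi> $ x / r x (Suc (\<xi> x)) else 1)" for z
    by (simp add: add_particle_def)
  have "r x (Suc (\<xi> x)) \<noteq> 0"
    using assms by (metis One_nat_def Suc_le_mono le0 less_irrefl)
  then show ?thesis
    by (simp only: zrp_weight_def eq prod.distrib) simp
qed

text \<open>Configurations empty at x drop out because \<open>r x 0 = 0\<close>. The others are
  reindexed by their background, where the rate is absorbed into the weight.\<close>

lemma sum_configurations_Suc:
  fixes r :: "'v::finite \<Rightarrow> nat \<Rightarrow> real"
  assumes "\<forall>x. \<forall>k\<ge>1. 0 < r x k" "r x 0 = 0"
  shows "(\<Sum>\<eta>\<in>configurations (Suc n). zrp_weight \<pi> r \<eta> * r x (\<eta> x) * G \<eta>) =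
    (\<Sum>\<xi>\<in>configurations n. zrp_weight \<pi> r \<xi> * \<pi> $ x * G (add_particle x \<xi>))"
proof -
  have "(\<Sum>\<eta>\<in>configurations (Suc n). zrp_weight \<pi> r \<eta> * r x (\<eta> x) * G \<eta>) =
      (\<Sum>\<eta>\<in>{\<eta> \<in> configurations (Suc n). \<eta> x \<noteq> 0}. zrp_weight \<pi> r \<eta> * r x (\<eta> x) * G \<eta>)"
    using assms(2) by (intro sum.mono_neutral_right) (auto simp: finite_configurations)
  also have "\<dots> = (\<Sum>\<xi>\<in>configurations n. zrp_weight \<pi> r (add_particle x \<xi>) *
      r x (add_particle x \<xi> x) * G (add_particle x \<xi>))"
    by (rule sum.reindex_bij_betw[symmetric]) (rule bij_betw_add_particle)
  also have "\<dots> = (\<Sum>\<xi>\<in>configurations n. zrp_weight \<pi> r \<xi> * \<pi> $ x * G (add_particle x \<xi>))"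
    by (simp add: add_particle_apply zrp_weight_add_particle[OF assms(1)])
  finally show ?thesis .
qed

lemma zrp_dirichlet_form_decomposition:
  fixes r :: "'v::finite \<Rightarrow> nat \<Rightarrow> real"
  assumes r: "\<forall>x. \<forall>k\<ge>1. 0 < r x k" "\<And>x. r x 0 = 0" and R: "stochastic_matrix R"
  shows "zrp_dirichlet_form R \<pi> r (Suc n) f g =
    (\<Sum>\<xi>\<in>configurations n. zrp_weight \<pi> r \<xi> *
      dirichlet_form R \<pi> (\<chi> x. f (add_particle x \<xi>)) (\<chi> x. g (add_particle x \<xi>))) /
    (\<Sum>\<eta>\<in>configurations (Suc n). zrp_weight \<pi> r \<eta>)"
proof -
  define Z where "Z = (\<Sum>\<eta>\<in>configurations (Suc n). zrp_weight \<pi> r \<eta>)"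
  define w where "w = zrp_weight \<pi> r"
  \<comment> \<open>The difference is oriented so as to absorb the minus sign of the Dirichlet
    form.\<close>
  define G where "G = (\<lambda>x y \<eta>. f \<eta> * (g \<eta> - g (move x y \<eta>)))"
  have "zrp_dirichlet_form R \<pi> r (Suc n) f g =
      (\<Sum>\<eta>\<in>configurations (Suc n). \<Sum>x\<in>UNIV. \<Sum>y\<in>UNIV. R $ x $ y * (w \<eta> * r x (\<eta> x) * G x y \<eta>)) / Z"
  proof -
    have "- (zrp_law \<pi> r (Suc n) \<eta> * f \<eta> * zrp_generator R r g \<eta>) =
        (\<Sum>x\<in>UNIV. \<Sum>y\<in>UNIV. R $ x $ y * (w \<eta> * r x (\<eta> x) * G x y \<eta>)) / Z" for \<eta>
    proof -
      have "- zrp_generator R r g \<eta> =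
          (\<Sum>x\<in>UNIV. \<Sum>y\<in>UNIV. r x (\<eta> x) * R $ x $ y * (g \<eta> - g (move x y \<eta>)))"
        unfolding zrp_generator_def UNIV_Times_UNIV[symmetric] sum.cartesian_product[symmetric]
        by (simp add: right_diff_distrib flip: sum_negf)
      then have "w \<eta> * f \<eta> * (- zrp_generator R r g \<eta>) =
          (\<Sum>x\<in>UNIV. \<Sum>y\<in>UNIV. R $ x $ y * (w \<eta> * r x (\<eta> x) * G x y \<eta>))"
        by (simp add: G_def sum_distrib_left mult_ac)
      moreover have "- (zrp_law \<pi> r (Suc n) \<eta> * f \<eta> * zrp_generator R r g \<eta>) =
          w \<eta> * f \<eta> * (- zrp_generator R r g \<eta>) / Z"
        by (simp add: zrp_law_def w_def Z_def)
      ultimately show ?thesis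
        by simp
    qed
    then show ?thesis
      by (simp add: zrp_dirichlet_form_def weighted_inner_def sum_divide_distrib flip: sum_negf)
  qed
  \<comment> \<open>The reindexing depends on the departure site, so the sums over sites are moved
    outside, the inner sum is rewritten for each fixed x and y, and the order is then
    restored.\<close>
  also have "(\<Sum>\<eta>\<in>configurations (Suc n). \<Sum>x\<in>UNIV. \<Sum>y\<in>UNIV. R $ x $ y * (w \<eta> * r x (\<eta> x) * G x y \<eta>)) =
      (\<Sum>x\<in>UNIV. \<Sum>y\<in>UNIV. R $ x $ y * (\<Sum>\<eta>\<in>configurations (Suc n). w \<eta> * r x (\<eta> x) * G x y \<eta>))"
    by (simp only: sum_distrib_left sum.swap[where A = "configurations (Suc n)" and B = UNIV])
  also have "\<dots> = (\<Sum>x\<in>UNIV. \<Sum>y\<in>UNIV. R $ x $ y *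
      (\<Sum>\<xi>\<in>configurations n. w \<xi> * \<pi> $ x * G x y (add_particle x \<xi>)))"
    unfolding w_def by (simp only: sum_configurations_Suc[OF r])
  also have "\<dots> = (\<Sum>\<xi>\<in>configurations n. \<Sum>x\<in>UNIV. \<Sum>y\<in>UNIV.
      R $ x $ y * (w \<xi> * \<pi> $ x * G x y (add_particle x \<xi>)))"
    by (simp only: sum_distrib_left sum.swap[where A = "configurations n" and B = UNIV])
  also have "\<dots> = (\<Sum>\<xi>\<in>configurations n. w \<xi> *
      dirichlet_form R \<pi> (\<chi> x. f (add_particle x \<xi>)) (\<chi> x. g (add_particle x \<xi>)))"
    by (simp add: dirichlet_form_eq_sum[OF R] G_def move_add_particle sum_distrib_left mult_ac)
  finally show ?thesis
    unfolding w_def Z_def .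
qed

section \<open>Comparison of the zero-range forms and optimality\<close>

theorem corollary3:
  fixes P :: "real ^ 'v ^ 'v"
    and \<pi> :: "real ^ 'v"
    and r :: "'v::finite \<Rightarrow> nat \<Rightarrow> real"
    and m :: nat
  assumes "CARD('v) \<ge> 2"
    and "m \<ge> 1"
    and "\<And>x k. k \<ge> 1 \<Longrightarrow> r x k > 0"
    and "\<And>x. r x 0 = 0"
    and "stochastic_matrix P"
    and "irreducible_matrix P"
    and "invariant_law P \<pi>"
  shows "(\<forall>f :: ('v \<Rightarrow> nat) \<Rightarrow> real.
            zrp_dirichlet_form P \<pi> r m f f
              \<ge> poincare_constant P \<pi> * zrp_dirichlet_form (constant_rows \<pi>) \<pi> r m f f)
       \<and> (\<exists>f :: ('v \<Rightarrow> nat) \<Rightarrow> real. \<not> f constant_on configurations m \<and>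
            zrp_dirichlet_form P \<pi> r m f f
              = poincare_constant P \<pi> * zrp_dirichlet_form (constant_rows \<pi>) \<pi> r m f f)"
proof -
  obtain n where n: "m = Suc n"
    using assms(2) by (cases m) auto
  have rates: "\<forall>x. \<forall>k\<ge>1. 0 < r x k"
    using assms(3) by simp
  note decomp = zrp_dirichlet_form_decomposition[OF rates assms(4)]
  \<comment> \<open>The values of \<open>f\<close> on the configurations reached from
    \<open>\<xi>\<close> by adding one particle, read as a vector indexed by the sites.\<close>
  define fib where "fib = (\<lambda>(f :: ('v \<Rightarrow> nat) \<Rightarrow> real) \<xi>. \<chi> x. f (add_particle x \<xi>))"
  define w where "w = zrp_weight \<pi> r"
  define Z where "Z = (\<Sum>\<eta>\<in>configurations (Suc n). w \<eta>)"
  have w_nonneg: "0 \<le> w \<eta>" for \<eta>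
    unfolding w_def using assms(7) by (intro zrp_weight_nonneg rates) (auto simp: invariant_law_def)
  have Z_nonneg: "0 \<le> Z"
    by (simp add: Z_def sum_nonneg w_nonneg)
  have sum1: "(\<Sum>x\<in>UNIV. \<pi> $ x) = 1"
    using assms(7) by (simp add: invariant_law_def)
  have formP: "zrp_dirichlet_form P \<pi> r m f f =
      (\<Sum>\<xi>\<in>configurations n. w \<xi> * dirichlet_form P \<pi> (fib f \<xi>) (fib f \<xi>)) / Z" for f
    unfolding n w_def Z_def fib_def by (rule decomp[OF assms(5)])
  have form\<Pi>: "poincare_constant P \<pi> * zrp_dirichlet_form (constant_rows \<pi>) \<pi> r m f f =
      (\<Sum>\<xi>\<in>configurations n. w \<xi> * (poincare_constant P \<pi> * variance \<pi> (fib f \<xi>))) / Z" for f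
    unfolding n w_def Z_def fib_def decomp[OF stochastic_constant_rows[OF assms(7)]]
    by (simp add: dirichlet_form_constant_rows[OF sum1] sum_distrib_left mult_ac)
  note poincare = assms(1,5-7)
  have "poincare_constant P \<pi> * zrp_dirichlet_form (constant_rows \<pi>) \<pi> r m f f
      \<le> zrp_dirichlet_form P \<pi> r m f f" for f
    unfolding formP form\<Pi>
    by (intro divide_right_mono sum_mono mult_left_mono w_nonneg Z_nonneg poincare_inequality[OF poincare])
  moreover have "\<exists>f :: ('v \<Rightarrow> nat) \<Rightarrow> real. \<not> f constant_on configurations m \<and>
      zrp_dirichlet_form P \<pi> r m f f
        = poincare_constant P \<pi> * zrp_dirichlet_form (constant_rows \<pi>) \<pi> r m f f"
  proof -
    obtain \<phi> where \<phi>: "\<not> ($) \<phi> constant_on UNIV"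
      and eq: "dirichlet_form P \<pi> \<phi> \<phi> = poincare_constant P \<pi> * variance \<pi> \<phi>"
      using poincare_constant_attained[OF poincare] by blast
    define f :: "('v \<Rightarrow> nat) \<Rightarrow> real" where "f = (\<lambda>\<eta>. \<Sum>z\<in>UNIV. \<phi> $ z * real (\<eta> z))"
    have f_add: "f (add_particle x \<xi>) = f \<xi> + \<phi> $ x" for x \<xi>
      by (simp add: f_def sum_add_particle)
    have "fib f \<xi> = \<phi> + vec (f \<xi>)" for \<xi>
      by (simp add: fib_def f_add vec_eq_iff)
    then have "zrp_dirichlet_form P \<pi> r m f f
        = poincare_constant P \<pi> * zrp_dirichlet_form (constant_rows \<pi>) \<pi> r m f f"
      unfolding formP form\<Pi>
      by (simp add: dirichlet_form_add_const[OF assms(5,7)] variance_add_const[OF sum1] eq)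
    moreover have "\<not> f constant_on configurations m"
    proof
      assume "f constant_on configurations m"
      then obtain c where c: "\<And>\<eta>. \<eta> \<in> configurations m \<Longrightarrow> f \<eta> = c"
        by (auto simp: constant_on_def)
      \<comment> \<open>Any background of n particles would do; here all of them sit at the
        arbitrary site \<open>undefined\<close>. Adding one more particle at each x in turn forces
        \<open>\<phi>\<close> to be constant.\<close>
      define \<xi> where "\<xi> = (\<lambda>z :: 'v. if z = undefined then n else 0)"
      have "\<xi> \<in> configurations n"
        by (simp add: \<xi>_def configurations_def)
      then have "f \<xi> + \<phi> $ x = c" for x
        using c[of "add_particle x \<xi>"] by (simp add: n add_particle_in_configurations f_add)
      then have "\<phi> $ x = c - f \<xi>" for x
        by (simp add: algebra_simps)
      then show False
        using \<phi> by (auto simp: constant_on_def)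
    qed
    ultimately show ?thesis
      by blast
  qed
  ultimately show ?thesis
    by blast
qed

end
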